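(* Let $m=1$, let $\nu\in\mathbb{N}$, $\nu\ge1$, and let $\hat\Theta$ be a solution of the dual problem $\min\{J(\Theta):\Theta\in\mathcal{D}_A\}$. Then $\mathcal{A}_{\hat\Theta,\nu}$ is the closest spectral density to the correlogram $\Omega$, according to the divergence $\mathcal{S}_{B2,\Psi^{\nu^{-1}}}^{(1-\nu^{-1})}(\Omega\|\mathcal{A}_{\Theta,\nu})$, among those belonging to the parametric class $\mathcal{M}_A=\{\mathcal{A}_{\Theta,\nu}:\Theta\in\mathcal{D}_A\}$; that is, $$\hat\Theta=\mathrm{argmin}_{\Theta\in\mathcal{D}_A}\ \mathcal{S}_{B2,\Psi^{\nu^{-1}}}^{(1-\nu^{-1})}(\Omega\|\mathcal{A}_{\Theta,\nu}).$$
   Context: Scalar case $m=1$. $\mathcal{S}_1^+$ is the set of scalar spectral densities of real stationary processes (nonnegative functions on the unit circle, symmetric under complex conjugation of the argument) that are bounded and bounded away from zero. $\mathcal{Q}_n$ is the space of real symmetric $n\times n$ matrices. $\int$ is integration over the unit circle with respect to normalized Lebesgue measure; $*$ is conjugate transpose on the unit circle; inequalities between functions hold on the whole unit circle. Setting: $G(z)=(zI-A)^{-1}B$ with $A\in\mathbb{R}^{n\times n}$ having all eigenvalues in the open unit disc, $B\in\mathbb{R}^{n\times 1}$, $n>1$, and $(A,B)$ reachable. $\Psi\in\mathcal{S}_1^+$ is a prior spectral density of bounded McMillan degree (rational). $\Omega>0$ is the (possibly truncated by the Blackman-Tukey method) biased correlogram computed from real data $\mathrm{y}(1),\dots,\mathrm{y}(N)$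 (a trigonometric polynomial, so $\Omega\in\mathcal{S}_1^+$), and $\hat\Sigma=\int G\Omega G^*$. For $\Theta\in\mathcal{D}_A=\{\Theta\in\mathcal{Q}_n:1+\nu^{-1}G^*\Theta G>0\}$ put $$\mathcal{A}_{\Theta,\nu}=\frac{\Psi}{(1+\nu^{-1}G^*\Theta G)^\nu},$$ and define the dual function $$J(\Theta)=\int\Psi\log(1+G^*\Theta G)^{-1}+\mathrm{tr}(\hat\Sigma\Theta)\quad(\nu=1),$$ $$J(\Theta)=\tfrac{\nu}{\nu-1}\int\Psi(1+\nu^{-1}G^*\Theta G)^{1-\nu}+\mathrm{tr}(\hat\Sigma\Theta)\quad(\nu>1).$$ It is known that the dual problem $\min_{\mathcal{D}_A}J$ admits solutions and that $\mathcal{A}_{\hat\Theta,\nu}$ is the unique minimizer over $\Phi\in\mathcal{S}_1^+$, subject to $\int G\Phi G^*=\hat\Sigma$, of the Alpha divergence $\mathcal{S}_A^{(1-\nu^{-1})}(\Phi\|\Psi)$, where $\mathcal{S}_A^{(\alpha)}(\Phi\|\Psi)=\int[\frac{1}{\alpha(\alpha-1)}\Phi^\alpha\Psi^{1-\alpha}-\frac{1}{\alpha-1}\Phi+\frac1\alpha\Psi]$ for $\alpha\ne0,1$ and $\mathcal{S}_A^{(0)}(\Phi\|\Psi)=\int[\Psi(\log\Psi-\log\Phi)-\Psi+\Phi]$. Weighted Beta divergence (second type), for a weight $Q\in\mathcal{S}_1^+$: for $\beta\in\mathbb{R}\setminus\{0,1\}$, $\mathcal{S}_{B2,Q}^{(\beta)}(\Phi_1\|\Phi_2)=\int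 Q[\frac{1}{\beta(\beta-1)}\Phi_1^\beta-\frac{1}{\beta-1}\Phi_1\Phi_2^{\beta-1}+\frac1\beta\Phi_2^\beta]$; for $\beta=0$, by continuity, $\mathcal{S}_{B2,Q}^{(0)}(\Phi_1\|\Phi_2)=\mathcal{S}_{IS,Q}(\Phi_1\|\Phi_2)=\int Q[\log\Phi_2-\log\Phi_1+\Phi_1\Phi_2^{-1}-1]$. *)

theory Defs
  imports "HOL-Analysis.Analysis" "HOL-Computational_Algebra.Polynomial"
begin

definition circle_integral :: "(complex \<Rightarrow> 'b::euclidean_space) \<Rightarrow> 'b" where
  "circle_integral f = (1 / (2 * pi)) *\<^sub>R (LBINT t:{0..2 * pi}. f (cis t))"

text \<open>
  A scalar spectral density is a function \<open>complex \<Rightarrow> real\<close> of which only the values on the unit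
  circle \<^term>\<open>sphere (0::complex) 1\<close> matter.
\<close>

definition S1_plus :: "(complex \<Rightarrow> real) set" where
  "S1_plus = {\<Phi>. (\<lambda>t. \<Phi> (cis t)) \<in> borel_measurable borel
      \<and> (\<forall>z\<in>sphere 0 1. \<Phi> (cnj z) = \<Phi> z)
      \<and> (\<exists>c C. 0 < c \<and> (\<forall>z\<in>sphere 0 1. c \<le> \<Phi> z \<and> \<Phi> z \<le> C))}"

definition rational_on_circle :: "(complex \<Rightarrow> real) \<Rightarrow> bool" where
  "rational_on_circle \<Phi> \<longleftrightarrow> (\<exists>p q :: complex poly. \<forall>z\<in>sphere 0 1.
      poly q z \<noteq> 0 \<and> complex_of_real (\<Phi> z) = poly p z / poly q z)"


abbreviation cmat :: "real ^ 'm ^ 'n \<Rightarrow> complex ^ 'm ^ 'n" where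
  "cmat A \<equiv> map_matrix complex_of_real A"

definition cvec :: "real ^ 'n \<Rightarrow> complex ^ 'n" where
  "cvec b = (\<chi> i. complex_of_real (b $ i))"

definition schur_stable :: "real ^ 'n ^ 'n \<Rightarrow> bool" where
  "schur_stable A \<longleftrightarrow>
     (\<forall>(\<mu>::complex) v. v \<noteq> 0 \<and> cmat A *v v = \<mu> *s v \<longrightarrow> cmod \<mu> < 1)"

text \<open>The columns of the reachability matrix \<open>[B, A B, \<dots>, A\<^sup>n\<^sup>-\<^sup>1 B]\<close> span the state space.\<close>

definition reachable :: "real ^ 'n ^ 'n \<Rightarrow> real ^ 'n \<Rightarrow> bool" where
  "reachable A B \<longleftrightarrow> span {(((*v) A) ^^ k) B | k. k < CARD('n)} = UNIV"

definition G_fun :: "real ^ 'n ^ 'n \<Rightarrow> real ^ 'n \<Rightarrow> complex \<Rightarrow> complex ^ 'n" where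
  "G_fun A B z = matrix_inv (mat z - cmat A) *v cvec B"

text \<open>The matrix \<open>G \<Phi> G\<^sup>*\<close> and the scalar \<open>G\<^sup>* \<Theta> G\<close> at a point of the unit circle.\<close>

definition G_Phi_Gstar ::
    "real ^ 'n ^ 'n \<Rightarrow> real ^ 'n \<Rightarrow> (complex \<Rightarrow> real) \<Rightarrow> complex \<Rightarrow> complex ^ 'n ^ 'n" where
  "G_Phi_Gstar A B \<Phi> z =
     (\<chi> i j. G_fun A B z $ i * complex_of_real (\<Phi> z) * cnj (G_fun A B z $ j))"

definition Gstar_Theta_G_complex ::
    "real ^ 'n ^ 'n \<Rightarrow> real ^ 'n \<Rightarrow> real ^ 'n ^ 'n \<Rightarrow> complex \<Rightarrow> complex" where
  "Gstar_Theta_G_complex A B \<Theta> z =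
     (\<Sum>i\<in>UNIV. cnj (G_fun A B z $ i) * (cmat \<Theta> *v G_fun A B z) $ i)"

lemma Gstar_Theta_G_real:
  assumes "transpose \<Theta> = \<Theta>"
  shows "Gstar_Theta_G_complex A B \<Theta> z \<in> \<real>"
proof -
  have sym: "\<Theta> $ i $ j = \<Theta> $ j $ i" for i j
    using assms by (metis transpose_def vec_lambda_beta)
  define g where "g = G_fun A B z"
  have e: "Gstar_Theta_G_complex A B \<Theta> z
      = (\<Sum>i\<in>UNIV. \<Sum>j\<in>UNIV. cnj (g $ i) * (of_real (\<Theta> $ i $ j) * g $ j))"
    by (simp add: Gstar_Theta_G_complex_def matrix_vector_mult_def g_def sum_distrib_left)
  have "cnj (Gstar_Theta_G_complex A B \<Theta> z)
      = (\<Sum>i\<in>UNIV. \<Sum>j\<in>UNIV. g $ i * (of_real (\<Theta> $ i $ j) * cnj (g $ j)))"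
    by (simp add: e)
  also have "\<dots> = (\<Sum>j\<in>UNIV. \<Sum>i\<in>UNIV. g $ i * (of_real (\<Theta> $ i $ j) * cnj (g $ j)))"
    by (rule sum.swap)
  also have "\<dots> = Gstar_Theta_G_complex A B \<Theta> z"
    unfolding e by (intro sum.cong refl) (simp add: sym mult_ac)
  finally show ?thesis
    by (simp add: Reals_cnj_iff)
qed

definition Gstar_Theta_G ::
    "real ^ 'n ^ 'n \<Rightarrow> real ^ 'n \<Rightarrow> real ^ 'n ^ 'n \<Rightarrow> complex \<Rightarrow> real" where
  "Gstar_Theta_G A B \<Theta> z = Re (Gstar_Theta_G_complex A B \<Theta> z)"


definition biased_covariance :: "(nat \<Rightarrow> real) \<Rightarrow> nat \<Rightarrow> nat \<Rightarrow> real" where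
  "biased_covariance y N k = (1 / real N) * (\<Sum>t=k+1..N. y t * y (t - k))"

text \<open>
  The biased correlogram of the data \<open>y 1, \<dots>, y N\<close> with the Blackman-Tukey lag window
  \<open>w \<bar>k\<bar>\<close>, truncated to the lags \<open>\<bar>k\<bar> < M\<close>. The untruncated correlogram is the case
  \<open>M = N\<close>, \<open>w = (\<lambda>_. 1)\<close>. The trigonometric polynomial is real on the unit circle.
\<close>

definition correlogram_complex ::
    "(nat \<Rightarrow> real) \<Rightarrow> nat \<Rightarrow> nat \<Rightarrow> (nat \<Rightarrow> real) \<Rightarrow> complex \<Rightarrow> complex" where
  "correlogram_complex y N M w z =
     (\<Sum>k\<in>{- int M<..<int M}.
        complex_of_real (w (nat \<bar>k\<bar>) * biased_covariance y N (nat \<bar>k\<bar>)) * z powi (- k))"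

lemma correlogram_real:
  assumes "z \<in> sphere 0 1"
  shows "correlogram_complex y N M w z \<in> \<real>"
proof -
  have n: "norm z = 1" using assms by simp
  then have c: "cnj z = inverse z"
    by (metis complex_div_cnj inverse_eq_divide of_real_1 one_power2 div_by_1 mult_1_left)
  have "cnj (correlogram_complex y N M w z) = (\<Sum>k\<in>{- int M<..<int M}.
        complex_of_real (w (nat \<bar>k\<bar>) * biased_covariance y N (nat \<bar>k\<bar>)) * z powi k)"
    unfolding correlogram_complex_def
    by (auto intro!: sum.cong simp: c power_int_minus power_int_inverse)
  also have "\<dots> = correlogram_complex y N M w z"
    unfolding correlogram_complex_def
    by (rule sum.reindex_bij_witness[of _ uminus uminus]) auto
  finally show ?thesis
    by (simp add: Reals_cnj_iff)
qed

definition correlogram ::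
    "(nat \<Rightarrow> real) \<Rightarrow> nat \<Rightarrow> nat \<Rightarrow> (nat \<Rightarrow> real) \<Rightarrow> complex \<Rightarrow> real" where
  "correlogram y N M w z = Re (correlogram_complex y N M w z)"


definition D_A :: "real ^ 'n ^ 'n \<Rightarrow> real ^ 'n \<Rightarrow> nat \<Rightarrow> (real ^ 'n ^ 'n) set" where
  "D_A A B \<nu> = {\<Theta>. transpose \<Theta> = \<Theta> \<and>
     (\<forall>z\<in>sphere 0 1. 0 < 1 + inverse (real \<nu>) * Gstar_Theta_G A B \<Theta> z)}"

definition A_density ::
    "real ^ 'n ^ 'n \<Rightarrow> real ^ 'n \<Rightarrow> (complex \<Rightarrow> real) \<Rightarrow> nat \<Rightarrow> real ^ 'n ^ 'n \<Rightarrow> complex \<Rightarrow> real" where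
  "A_density A B \<Psi> \<nu> \<Theta> z = \<Psi> z / (1 + inverse (real \<nu>) * Gstar_Theta_G A B \<Theta> z) ^ \<nu>"

definition M_A ::
    "real ^ 'n ^ 'n \<Rightarrow> real ^ 'n \<Rightarrow> (complex \<Rightarrow> real) \<Rightarrow> nat \<Rightarrow> (complex \<Rightarrow> real) set" where
  "M_A A B \<Psi> \<nu> = A_density A B \<Psi> \<nu> ` D_A A B \<nu>"

definition Sigma_hat ::
    "real ^ 'n ^ 'n \<Rightarrow> real ^ 'n \<Rightarrow> (complex \<Rightarrow> real) \<Rightarrow> complex ^ 'n ^ 'n" where
  "Sigma_hat A B \<Omega> = circle_integral (G_Phi_Gstar A B \<Omega>)"

text \<open>
  Since \<^term>\<open>Sigma_hat A B \<Omega>\<close> is Hermitian, its product with a real symmetric matrix has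
  real trace, so that taking the real part below loses nothing.
\<close>

definition dual_J ::
    "real ^ 'n ^ 'n \<Rightarrow> real ^ 'n \<Rightarrow> (complex \<Rightarrow> real) \<Rightarrow> (complex \<Rightarrow> real) \<Rightarrow> nat
      \<Rightarrow> real ^ 'n ^ 'n \<Rightarrow> real" where
  "dual_J A B \<Psi> \<Omega> \<nu> \<Theta> =
     (if \<nu> = 1
      then circle_integral (\<lambda>z. \<Psi> z * ln (inverse (1 + Gstar_Theta_G A B \<Theta> z)))
      else real \<nu> / (real \<nu> - 1) *
        circle_integral (\<lambda>z. \<Psi> z *
          (1 + inverse (real \<nu>) * Gstar_Theta_G A B \<Theta> z) powr (1 - real \<nu>)))
     + Re (trace (Sigma_hat A B \<Omega> ** cmat \<Theta>))"


definition S_IS :: "(complex \<Rightarrow> real) \<Rightarrow> (complex \<Rightarrow> real) \<Rightarrow> (complex \<Rightarrow> real) \<Rightarrow> real" where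
  "S_IS Q \<Phi>1 \<Phi>2 = circle_integral (\<lambda>z. Q z *
     (ln (\<Phi>2 z) - ln (\<Phi>1 z) + \<Phi>1 z * inverse (\<Phi>2 z) - 1))"

text \<open>The value at \<open>\<beta> = 1\<close>, where the formula degenerates, is meaningless.\<close>

definition S_B2 ::
    "(complex \<Rightarrow> real) \<Rightarrow> real \<Rightarrow> (complex \<Rightarrow> real) \<Rightarrow> (complex \<Rightarrow> real) \<Rightarrow> real" where
  "S_B2 Q \<beta> \<Phi>1 \<Phi>2 =
     (if \<beta> = 0 then S_IS Q \<Phi>1 \<Phi>2
      else circle_integral (\<lambda>z. Q z *
        (1 / (\<beta> * (\<beta> - 1)) * \<Phi>1 z powr \<beta>
         - 1 / (\<beta> - 1) * \<Phi>1 z * \<Phi>2 z powr (\<beta> - 1)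
         + 1 / \<beta> * \<Phi>2 z powr \<beta>)))"

end

theory Submission
  imports Defs
begin

text \<open>
  Write \<open>s = 1 + \<nu>\<inverse> G\<^sup>* \<Theta> G\<close>, so that the model density is
  \<open>\<Psi> s\<^bsup>-\<nu>\<^esup>\<close>. The order \<open>1 - \<nu>\<inverse>\<close> and the weight
  \<open>\<Psi>\<^bsup>1/\<nu>\<^esup>\<close> of the divergence are matched to this form: the cross term
  \<open>\<Omega> (\<Psi> s\<^bsup>-\<nu>\<^esup>)\<^bsup>-1/\<nu>\<^esup>\<close>, once weighted, is \<open>\<Omega> s\<close>,
  hence affine in \<open>\<Theta>\<close>, and its integral is, up to a constant and the factor
  \<open>\<nu>\<inverse>\<close>, the term \<open>tr (\<Sigma> \<Theta>)\<close> of the dual function, because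
  \<open>\<Sigma> = \<integral> G \<Omega> G\<^sup>*\<close>. The weighted pure term in the model density is
  \<open>\<Psi> s\<^bsup>1-\<nu>\<^esup>\<close> up to a factor (\<open>- \<Psi> ln s\<close> for \<open>\<nu> = 1\<close>),
  which is the other term of the dual function. All that remains depends on
  \<open>\<Psi>\<close> and \<open>\<Omega>\<close> only. So the divergence equals the dual function plus a
  constant (\<open>S_B2_eq_dual_J\<close>), and both have the same minimizers over \<open>\<Theta>\<close>.

  The minimizing density is moreover unique, although \<open>\<Theta>\<close> itself need not be, since the
  dual function sees \<open>\<Theta>\<close> only through \<open>G\<^sup>* \<Theta> G\<close>. As a function of \<open>s\<close> its
  integrand is strictly convex, so two minimizers whose \<open>G\<^sup>* \<Theta> G\<close> differed somewhere on the
  circle would be beaten by their midpoint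
  (\<open>dual_J_minimizers_same_Gstar_Theta_G\<close>).

  Every function involved is continuous on the circle: \<open>\<Psi>\<close> as a rational function without
  poles there, \<open>\<Omega>\<close> as a trigonometric polynomial, and \<open>G\<close> by stability of
  \<open>A\<close> and Cramer's rule. This gives integrability, and it turns equality almost everywhere
  into equality everywhere.
\<close>

section \<open>Integration over the circle\<close>

lemma set_integrable_circle:
  fixes f :: "complex \<Rightarrow> 'b::euclidean_space"
  assumes "continuous_on (sphere 0 1) f"
  shows "set_integrable lborel {0..2 * pi} (\<lambda>t. f (cis t))"
  unfolding set_integrable_def
proof (rule borel_integrable_compact)
  show "continuous_on {0..2 * pi} (\<lambda>t. f (cis t))"
    by (rule continuous_on_compose2[OF assms]) (auto intro!: continuous_intros)
qed simp

lemma circle_integral_cong: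
  fixes f g :: "complex \<Rightarrow> 'b::euclidean_space"
  assumes "\<And>z. z \<in> sphere 0 1 \<Longrightarrow> f z = g z"
  shows "circle_integral f = circle_integral g"
  unfolding circle_integral_def
  by (intro arg_cong2[where f = scaleR] refl set_lebesgue_integral_cong) (auto intro: assms)

lemma circle_integral_add:
  fixes f g :: "complex \<Rightarrow> 'b::euclidean_space"
  assumes "continuous_on (sphere 0 1) f" "continuous_on (sphere 0 1) g"
  shows "circle_integral (\<lambda>z. f z + g z) = circle_integral f + circle_integral g"
  unfolding circle_integral_def
  by (simp add: set_integral_add[OF assms[THEN set_integrable_circle]] scaleR_add_right)

lemma circle_integral_bounded_linear:
  fixes f :: "complex \<Rightarrow> 'b::euclidean_space" and T :: "'b \<Rightarrow> 'c::euclidean_space"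
  assumes T: "bounded_linear T" and f: "continuous_on (sphere 0 1) f"
  shows "circle_integral (\<lambda>z. T (f z)) = T (circle_integral f)"
proof -
  interpret bounded_linear T by fact
  have "(LBINT t:{0..2*pi}. T (f (cis t))) = T (LBINT t:{0..2*pi}. f (cis t))"
    using integral_bounded_linear[OF T set_integrable_circle[OF f, unfolded set_integrable_def]]
    by (simp add: set_lebesgue_integral_def scaleR)
  then show ?thesis
    by (simp add: circle_integral_def scaleR)
qed

lemma circle_integral_cmult:
  fixes f :: "complex \<Rightarrow> real"
  assumes "continuous_on (sphere 0 1) f"
  shows "circle_integral (\<lambda>z. c * f z) = c * circle_integral f"
  by (rule circle_integral_bounded_linear[OF bounded_linear_mult_right assms])

text \<open>
  Continuity is what excludes nonzero values on a null set.
\<close>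

lemma circle_integral_nonpos_imp_zero:
  fixes f :: "complex \<Rightarrow> real"
  assumes cont: "continuous_on (sphere 0 1) f"
    and nonneg: "\<And>z. z \<in> sphere 0 1 \<Longrightarrow> 0 \<le> f z"
    and le: "circle_integral f \<le> 0"
    and z: "z \<in> sphere 0 1"
  shows "f z = 0"
proof -
  have c: "continuous_on {0..2 * pi} (\<lambda>t. f (cis t))"
    by (rule continuous_on_compose2[OF cont]) (auto intro!: continuous_intros)
  have eq: "(LBINT t:{0..2*pi}. f (cis t)) = integral {0..2*pi} (\<lambda>t. f (cis t))"
    by (rule set_borel_integral_eq_integral(2)[OF set_integrable_circle[OF cont]])
  have "integral {0..2*pi} (\<lambda>t. f (cis t)) \<ge> 0"
    by (rule integral_nonneg[OF integrable_continuous_real[OF c]]) (simp add: nonneg)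
  moreover have "integral {0..2*pi} (\<lambda>t. f (cis t)) \<le> 0"
    using le pi_gt_zero by (auto simp: circle_integral_def eq divide_le_0_iff)
  ultimately have "\<forall>t\<in>{0..2*pi}. f (cis t) = 0"
    using integral_eq_0_iff[OF c] nonneg by auto
  moreover obtain t where "0 \<le> t" "t < 2 * pi" "z = cis t"
    using z Arg2pi_ge_0 Arg2pi_lt_2pi Arg2pi_eq[of z]
    by (metis (no_types) cis_conv_exp mem_sphere_0 mult_1 of_real_1)
  ultimately show ?thesis by auto
qed

section \<open>The strictly convex potential of the dual function\<close>

text \<open>
  The scalar function of \<open>s\<close> that the dual function integrates against \<open>\<Psi>\<close>.
  The two branches are primitives of the same expression \<open>- \<nu> s\<^bsup>-\<nu>\<^esup>\<close>, by which
  they are treated together.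
\<close>

definition dual_potential :: "nat \<Rightarrow> real \<Rightarrow> real" where
  "dual_potential \<nu> s =
     (if \<nu> = 1 then - ln s else real \<nu> / (real \<nu> - 1) * s powr (1 - real \<nu>))"

lemma DERIV_dual_potential:
  assumes "1 \<le> \<nu>" "0 < s"
  shows "(dual_potential \<nu> has_real_derivative - real \<nu> * s powr (- real \<nu>)) (at s)"
proof (cases "\<nu> = 1")
  case True
  have "((\<lambda>s. - ln s) has_real_derivative - (1 / s)) (at s)"
    using assms by (auto intro!: derivative_eq_intros)
  with True assms show ?thesis
    by (simp add: dual_potential_def[abs_def] powr_minus divide_inverse)
next
  case False
  have "((\<lambda>s. real \<nu> / (real \<nu> - 1) * s powr (1 - real \<nu>)) has_real_derivative
      real \<nu> / (real \<nu> - 1) * ((1 - real \<nu>) * s powr (1 - real \<nu> - 1))) (at s)"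
    using assms by (intro DERIV_cmult has_real_derivative_powr)
  moreover have "real \<nu> / (real \<nu> - 1) * ((1 - real \<nu>) * s powr (1 - real \<nu> - 1))
      = - real \<nu> * s powr (- real \<nu>)"
    using False by (simp add: field_simps)
  ultimately show ?thesis
    using False by (simp add: dual_potential_def[abs_def])
qed

text \<open>
  Strict convexity, from the strictly increasing derivative: the mean value theorem on either half
  of the interval compares the two increments.
\<close>

lemma dual_potential_midpoint_less:
  assumes \<nu>: "1 \<le> \<nu>" and "0 < a" "0 < b" "a \<noteq> b"
  shows "2 * dual_potential \<nu> ((a + b) / 2) < dual_potential \<nu> a + dual_potential \<nu> b"
proof -
  have *: "2 * dual_potential \<nu> ((a + b) / 2) < dual_potential \<nu> a + dual_potential \<nu> b"
    if "0 < a" "a < b" for a b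
  proof -
    define m where "m = (a + b) / 2"
    have m: "a < m" "m < b" using that by (auto simp: m_def)
    let ?d = "\<lambda>s. - real \<nu> * s powr (- real \<nu>)"
    have D: "(dual_potential \<nu> has_real_derivative ?d s) (at s)" if "a \<le> s" for s
      using DERIV_dual_potential[OF \<nu>] that \<open>0 < a\<close> by auto
    obtain x where x: "a < x" "x < m"
        "dual_potential \<nu> m - dual_potential \<nu> a = (m - a) * ?d x"
      using MVT2[OF m(1) D] that m by auto
    obtain y where y: "m < y" "y < b"
        "dual_potential \<nu> b - dual_potential \<nu> m = (b - m) * ?d y"
      using MVT2[OF m(2) D] that m by auto
    have "y powr (- real \<nu>) < x powr (- real \<nu>)"
      using \<nu> that x y by (intro powr_less_mono2_neg) auto
    then have "?d x < ?d y" using \<nu> by simp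
    then have "(m - a) * ?d x < (m - a) * ?d y" by (rule mult_strict_left_mono) (use m in simp)
    moreover have "b - m = m - a" by (simp add: m_def field_simps)
    ultimately show ?thesis using x(3) y(3) by (simp add: m_def[symmetric])
  qed
  show ?thesis
    using *[of a b] *[of b a] assms by (cases "a < b") (auto simp: add.commute)
qed

lemma dual_potential_midpoint_le:
  assumes "1 \<le> \<nu>" "0 < a" "0 < b"
  shows "2 * dual_potential \<nu> ((a + b) / 2) \<le> dual_potential \<nu> a + dual_potential \<nu> b"
  using dual_potential_midpoint_less[OF assms] by (cases "a = b") auto

lemma continuous_on_dual_potential:
  assumes "1 \<le> \<nu>" "continuous_on S f" "\<And>x. x \<in> S \<Longrightarrow> 0 < f x"
  shows "continuous_on S (\<lambda>x. dual_potential \<nu> (f x))"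
proof (rule continuous_on_compose2[OF _ assms(2)])
  show "continuous_on {0<..} (dual_potential \<nu>)"
    using DERIV_dual_potential[OF assms(1)]
    by (auto intro!: continuous_at_imp_continuous_on dest: DERIV_isCont)
  show "f ` S \<subseteq> {0<..}" using assms(3) by auto
qed

section \<open>The transfer function on the unit circle\<close>

lemma invertible_matrix_inv_right:
  assumes "invertible M"
  shows "M ** matrix_inv M = mat 1"
  using assms unfolding invertible_def matrix_inv_def by (rule someI2_ex) simp

text \<open>
  A kernel vector would be an eigenvector of \<open>A\<close> for an eigenvalue of modulus one.
\<close>

lemma schur_stable_invertible:
  assumes "schur_stable A" "z \<in> sphere 0 1"
  shows "invertible (mat z - cmat A)"
proof -
  have "v = 0" if "(mat z - cmat A) *v v = 0" for v
  proof (rule ccontr)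
    assume "v \<noteq> 0"
    moreover have "mat z *v v = z *s v"
      by (simp add: vec_eq_iff matrix_vector_mult_def mat_def if_distrib[of "\<lambda>x. x * _"]
          cong: if_cong)
    with that have "cmat A *v v = z *s v"
      by (simp add: matrix_vector_mult_diff_rdistrib)
    ultimately have "cmod z < 1"
      using assms(1) by (auto simp: schur_stable_def)
    with assms(2) show False by simp
  qed
  then show ?thesis
    using matrix_left_invertible_ker invertible_left_inverse by blast
qed

lemma continuous_on_det:
  fixes f :: "'a::topological_space \<Rightarrow> 'b::real_normed_field ^ 'n ^ 'n"
  assumes "\<And>i j. continuous_on S (\<lambda>x. f x $ i $ j)"
  shows "continuous_on S (\<lambda>x. det (f x))"
  unfolding det_def by (intro continuous_intros assms)

text \<open>
  Cramer's rule writes the entries of \<open>(z I - A)\<inverse> B\<close> as quotients of determinants, each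
  a polynomial in \<open>z\<close>, with a denominator that stability keeps away from zero.
\<close>

lemma continuous_on_G_fun:
  assumes "schur_stable A"
  shows "continuous_on (sphere 0 1) (G_fun A B)"
proof -
  define C where "C z = mat z - cmat A" for z
  have C_cont: "continuous_on (sphere 0 1) (\<lambda>z. C z $ i $ j)" for i j
    by (cases "i = j") (auto simp: C_def mat_def intro!: continuous_intros)
  have inv: "invertible (C z)" if "z \<in> sphere 0 1" for z
    unfolding C_def by (rule schur_stable_invertible[OF assms that])
  have det: "det (C z) \<noteq> 0" if "z \<in> sphere 0 1" for z
    using inv[OF that] by (simp add: invertible_det_nz)
  define X where "X z = (\<chi> k. det (\<chi> i j. if j = k then cvec B $ i else C z $ i $ j) / det (C z))"
    for z
  have "X z = G_fun A B z" if z: "z \<in> sphere 0 1" for z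
  proof -
    have "C z *v G_fun A B z = cvec B"
      using invertible_matrix_inv_right[OF inv[OF z]]
      by (simp add: G_fun_def C_def[symmetric] matrix_vector_mul_assoc)
    then show ?thesis using cramer[OF det[OF z]] by (simp add: X_def)
  qed
  moreover have "continuous_on (sphere 0 1) X"
    unfolding X_def[abs_def]
  proof (intro continuous_on_vec_lambda continuous_on_divide continuous_on_det)
    show "continuous_on (sphere 0 1)
        (\<lambda>z. (\<chi> i j. if j = k then cvec B $ i else C z $ i $ j) $ i $ j)" for k i j
      by (cases "j = k") (auto intro: C_cont)
  qed (use C_cont det in auto)
  ultimately show ?thesis using continuous_on_eq by blast
qed

lemma continuous_on_Gstar_Theta_G:
  assumes "schur_stable A"
  shows "continuous_on (sphere 0 1) (Gstar_Theta_G A B \<Theta>)"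
  unfolding Gstar_Theta_G_def[abs_def] Gstar_Theta_G_complex_def matrix_vector_mult_def
  by (intro continuous_intros) (auto intro!: continuous_intros continuous_on_G_fun assms)

lemma Gstar_Theta_G_midpoint:
  "Gstar_Theta_G A B ((1/2) *\<^sub>R (\<Theta>1 + \<Theta>2)) z
     = (Gstar_Theta_G A B \<Theta>1 z + Gstar_Theta_G A B \<Theta>2 z) / 2"
proof -
  have "Gstar_Theta_G_complex A B ((1/2) *\<^sub>R (\<Theta>1 + \<Theta>2)) z
     = (1/2) * (Gstar_Theta_G_complex A B \<Theta>1 z + Gstar_Theta_G_complex A B \<Theta>2 z)"
    by (simp add: Gstar_Theta_G_complex_def matrix_vector_mult_def sum_distrib_left
        sum_divide_distrib sum.distrib[symmetric] algebra_simps add_divide_distrib)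
  show ?thesis
    unfolding Gstar_Theta_G_def \<open>Gstar_Theta_G_complex A B ((1/2) *\<^sub>R (\<Theta>1 + \<Theta>2)) z = _\<close> by simp
qed

lemma D_A_midpoint:
  assumes "\<Theta>1 \<in> D_A A B \<nu>" "\<Theta>2 \<in> D_A A B \<nu>"
  shows "(1/2) *\<^sub>R (\<Theta>1 + \<Theta>2) \<in> D_A A B \<nu>"
proof -
  have "transpose ((1/2) *\<^sub>R (\<Theta>1 + \<Theta>2)) = (1/2) *\<^sub>R (transpose \<Theta>1 + transpose \<Theta>2)"
    by (simp add: transpose_def vec_eq_iff)
  moreover have "0 < 1 + inverse (real \<nu>) * Gstar_Theta_G A B ((1/2) *\<^sub>R (\<Theta>1 + \<Theta>2)) z"
    if "z \<in> sphere 0 1" for z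
  proof -
    have pos: "0 < 1 + inverse (real \<nu>) * Gstar_Theta_G A B \<Theta>1 z"
        "0 < 1 + inverse (real \<nu>) * Gstar_Theta_G A B \<Theta>2 z"
      using assms that by (auto simp: D_A_def)
    have eq: "1 + c * ((a + b) / 2) = ((1 + c * a) + (1 + c * b)) / 2" for a b c :: real
      by (simp add: field_simps)
    show ?thesis
      unfolding Gstar_Theta_G_midpoint eq by (rule half_gt_zero[OF add_pos_pos[OF pos]])
  qed
  ultimately show ?thesis using assms by (auto simp: D_A_def)
qed

text \<open>
  The trace against \<open>\<Theta>\<close> is a linear functional, so it passes under the integral that
  defines \<open>\<Sigma>\<close>, and \<open>tr (G \<Omega> G\<^sup>* \<Theta>) = \<Omega> G\<^sup>* \<Theta> G\<close>.
\<close>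

lemma trace_Sigma_hat:
  assumes "schur_stable A" "continuous_on (sphere 0 1) \<Omega>"
  shows "Re (trace (Sigma_hat A B \<Omega> ** cmat \<Theta>))
    = circle_integral (\<lambda>z. \<Omega> z * Gstar_Theta_G A B \<Theta> z)"
proof -
  define T where "T X = Re (trace (X ** cmat \<Theta>))" for X :: "complex ^ 'a ^ 'a"
  have "linear T"
    by (intro linearI)
      (auto simp: T_def trace_def matrix_matrix_mult_def sum.distrib algebra_simps sum_distrib_left)
  then have T: "bounded_linear T" by (simp add: linear_conv_bounded_linear)
  have cont: "continuous_on (sphere 0 1) (G_Phi_Gstar A B \<Omega>)"
    unfolding G_Phi_Gstar_def[abs_def]
    by (intro continuous_intros) (auto intro!: continuous_intros continuous_on_G_fun assms)
  have "T (G_Phi_Gstar A B \<Omega> z) = \<Omega> z * Gstar_Theta_G A B \<Theta> z" for z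
  proof -
    let ?g = "G_fun A B z"
    have "trace (G_Phi_Gstar A B \<Omega> z ** cmat \<Theta>)
      = (\<Sum>i\<in>UNIV. \<Sum>j\<in>UNIV. ?g $ i * of_real (\<Omega> z) * cnj (?g $ j) * of_real (\<Theta> $ j $ i))"
      by (simp add: trace_def matrix_matrix_mult_def G_Phi_Gstar_def)
    also have "\<dots>
      = (\<Sum>j\<in>UNIV. \<Sum>i\<in>UNIV. ?g $ i * of_real (\<Omega> z) * cnj (?g $ j) * of_real (\<Theta> $ j $ i))"
      by (rule sum.swap)
    also have "\<dots> = of_real (\<Omega> z) * Gstar_Theta_G_complex A B \<Theta> z"
      by (simp add: Gstar_Theta_G_complex_def matrix_vector_mult_def sum_distrib_left mult_ac)
    finally show ?thesis by (simp add: T_def Gstar_Theta_G_def)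
  qed
  then show ?thesis
    using circle_integral_bounded_linear[OF T cont]
    by (simp add: T_def Sigma_hat_def)
qed

section \<open>The dual function as an integral and its minimizers\<close>

lemma continuous_on_D_A_factor:
  assumes "schur_stable A"
  shows "continuous_on (sphere 0 1) (\<lambda>z. 1 + inverse (real \<nu>) * Gstar_Theta_G A B \<Theta> z)"
  by (intro continuous_intros continuous_on_Gstar_Theta_G assms)

definition dual_integrand ::
    "real ^ 'n ^ 'n \<Rightarrow> real ^ 'n \<Rightarrow> (complex \<Rightarrow> real) \<Rightarrow> (complex \<Rightarrow> real) \<Rightarrow> nat
      \<Rightarrow> real ^ 'n ^ 'n \<Rightarrow> complex \<Rightarrow> real" where
  "dual_integrand A B \<Psi> \<Omega> \<nu> \<Theta> z =
     \<Psi> z * dual_potential \<nu> (1 + inverse (real \<nu>) * Gstar_Theta_G A B \<Theta> z)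
     + \<Omega> z * Gstar_Theta_G A B \<Theta> z"

lemma continuous_on_dual_integrand:
  assumes "schur_stable A" "continuous_on (sphere 0 1) \<Psi>" "continuous_on (sphere 0 1) \<Omega>"
    "1 \<le> \<nu>" "\<Theta> \<in> D_A A B \<nu>"
  shows "continuous_on (sphere 0 1) (dual_integrand A B \<Psi> \<Omega> \<nu> \<Theta>)"
  unfolding dual_integrand_def[abs_def]
  by (intro continuous_intros continuous_on_dual_potential assms continuous_on_Gstar_Theta_G)
    (use assms(5) in \<open>auto simp: D_A_def\<close>)

lemma dual_J_eq_circle_integral:
  assumes A: "schur_stable A"
    and \<Psi>: "continuous_on (sphere 0 1) \<Psi>" and \<Omega>: "continuous_on (sphere 0 1) \<Omega>"
    and \<nu>: "1 \<le> \<nu>" and \<Theta>: "\<Theta> \<in> D_A A B \<nu>"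
  shows "dual_J A B \<Psi> \<Omega> \<nu> \<Theta> = circle_integral (dual_integrand A B \<Psi> \<Omega> \<nu> \<Theta>)"
proof -
  let ?s = "\<lambda>z. 1 + inverse (real \<nu>) * Gstar_Theta_G A B \<Theta> z"
  have pos: "0 < ?s z" if "z \<in> sphere 0 1" for z
    using \<Theta> that by (auto simp: D_A_def)
  have cs: "continuous_on (sphere 0 1) ?s"
    by (rule continuous_on_D_A_factor[OF A])
  have "(if \<nu> = 1
      then circle_integral (\<lambda>z. \<Psi> z * ln (inverse (1 + Gstar_Theta_G A B \<Theta> z)))
      else real \<nu> / (real \<nu> - 1) * circle_integral (\<lambda>z. \<Psi> z * ?s z powr (1 - real \<nu>)))
    = circle_integral (\<lambda>z. \<Psi> z * dual_potential \<nu> (?s z))"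
  proof (cases "\<nu> = 1")
    case True
    then show ?thesis
      using pos by (auto intro!: circle_integral_cong simp: dual_potential_def ln_inverse)
  next
    case False
    have "continuous_on (sphere 0 1) (\<lambda>z. \<Psi> z * ?s z powr (1 - real \<nu>))"
      by (intro continuous_intros \<Psi> continuous_on_Gstar_Theta_G A) (use pos in force)
    from circle_integral_cmult[OF this, of "real \<nu> / (real \<nu> - 1)"] False
    show ?thesis
      by (simp add: dual_potential_def mult_ac)
  qed
  moreover have "continuous_on (sphere 0 1) (\<lambda>z. \<Psi> z * dual_potential \<nu> (?s z))"
    by (intro continuous_on_mult \<Psi> continuous_on_dual_potential \<nu> cs pos)
  moreover have "continuous_on (sphere 0 1) (\<lambda>z. \<Omega> z * Gstar_Theta_G A B \<Theta> z)"
    by (intro continuous_on_mult \<Omega> continuous_on_Gstar_Theta_G A)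
  ultimately show ?thesis
    unfolding dual_J_def dual_integrand_def[abs_def] trace_Sigma_hat[OF A \<Omega>]
    by (simp add: circle_integral_add)
qed

text \<open>
  The linear part of the integrand drops out of the midpoint gap
  \<open>J(\<Theta>\<^sub>1) + J(\<Theta>\<^sub>2) - 2 J((\<Theta>\<^sub>1 + \<Theta>\<^sub>2)/2)\<close>, which becomes
  the integral of \<open>\<Psi>\<close> times the convexity gap of the potential. That integrand is
  nonnegative, but minimality of both points makes the integral at most zero, so it
  vanishes identically, and strict convexity leaves only equal arguments.
\<close>

lemma dual_J_minimizers_same_Gstar_Theta_G:
  assumes A: "schur_stable A"
    and \<Psi>: "continuous_on (sphere 0 1) \<Psi>" "\<And>z. z \<in> sphere 0 1 \<Longrightarrow> 0 < \<Psi> z"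
    and \<Omega>: "continuous_on (sphere 0 1) \<Omega>"
    and \<nu>: "1 \<le> \<nu>"
    and min1: "is_arg_min (dual_J A B \<Psi> \<Omega> \<nu>) (\<lambda>\<Theta>. \<Theta> \<in> D_A A B \<nu>) \<Theta>1"
    and min2: "is_arg_min (dual_J A B \<Psi> \<Omega> \<nu>) (\<lambda>\<Theta>. \<Theta> \<in> D_A A B \<nu>) \<Theta>2"
    and z: "z \<in> sphere 0 1"
  shows "Gstar_Theta_G A B \<Theta>1 z = Gstar_Theta_G A B \<Theta>2 z"
proof -
  define \<Theta>m where "\<Theta>m = (1/2) *\<^sub>R (\<Theta>1 + \<Theta>2)"
  define s where "s \<Theta> z = 1 + inverse (real \<nu>) * Gstar_Theta_G A B \<Theta> z" for \<Theta> z
  have dom: "\<Theta>1 \<in> D_A A B \<nu>" "\<Theta>2 \<in> D_A A B \<nu>" "\<Theta>m \<in> D_A A B \<nu>"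
    using min1 min2 D_A_midpoint by (auto simp: is_arg_min_linorder \<Theta>m_def)
  note J = dual_J_eq_circle_integral[OF A \<Psi>(1) \<Omega> \<nu>]
  note cont = continuous_on_dual_integrand[OF A \<Psi>(1) \<Omega> \<nu>]
  define gap where "gap z = dual_integrand A B \<Psi> \<Omega> \<nu> \<Theta>1 z
      + dual_integrand A B \<Psi> \<Omega> \<nu> \<Theta>2 z + (- 2) * dual_integrand A B \<Psi> \<Omega> \<nu> \<Theta>m z" for z
  have pos: "0 < s \<Theta> z" if "\<Theta> \<in> D_A A B \<nu>" "z \<in> sphere 0 1" for \<Theta> z
    using that by (auto simp: D_A_def s_def)
  have mid_G: "Gstar_Theta_G A B \<Theta>m z = (Gstar_Theta_G A B \<Theta>1 z + Gstar_Theta_G A B \<Theta>2 z) / 2" for z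
    unfolding \<Theta>m_def by (rule Gstar_Theta_G_midpoint)
  have mid: "s \<Theta>m z = (s \<Theta>1 z + s \<Theta>2 z) / 2" for z
    by (simp add: s_def mid_G add_divide_distrib distrib_left)
  have gap: "gap z = \<Psi> z * (dual_potential \<nu> (s \<Theta>1 z) + dual_potential \<nu> (s \<Theta>2 z)
      - 2 * dual_potential \<nu> ((s \<Theta>1 z + s \<Theta>2 z) / 2))" for z
    unfolding mid[symmetric] gap_def dual_integrand_def s_def[symmetric]
    unfolding mid_G by (simp add: field_simps)
  have cont_gap: "continuous_on (sphere 0 1) gap"
    unfolding gap_def by (intro continuous_intros cont dom)
  have "circle_integral gap = dual_J A B \<Psi> \<Omega> \<nu> \<Theta>1 + dual_J A B \<Psi> \<Omega> \<nu> \<Theta>2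
      + (- 2) * dual_J A B \<Psi> \<Omega> \<nu> \<Theta>m"
  proof -
    let ?I = "dual_integrand A B \<Psi> \<Omega> \<nu>"
    have "continuous_on (sphere 0 1) (\<lambda>z. ?I \<Theta>1 z + ?I \<Theta>2 z)"
         "continuous_on (sphere 0 1) (\<lambda>z. (- 2) * ?I \<Theta>m z)"
      by (intro continuous_on_add continuous_on_mult continuous_on_const cont dom)+
    then have "circle_integral gap = circle_integral (\<lambda>z. ?I \<Theta>1 z + ?I \<Theta>2 z)
        + circle_integral (\<lambda>z. (- 2) * ?I \<Theta>m z)"
      unfolding gap_def[abs_def] by (rule circle_integral_add)
    also have "\<dots> = circle_integral (?I \<Theta>1) + circle_integral (?I \<Theta>2)
        + (- 2) * circle_integral (?I \<Theta>m)"
      by (simp only: circle_integral_add[OF cont[OF dom(1)] cont[OF dom(2)]]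
          circle_integral_cmult[OF cont[OF dom(3)]])
    finally show ?thesis
      by (simp only: J[OF dom(1)] J[OF dom(2)] J[OF dom(3)])
  qed
  also have "\<dots> \<le> 0"
  proof -
    have "dual_J A B \<Psi> \<Omega> \<nu> \<Theta>1 \<le> dual_J A B \<Psi> \<Omega> \<nu> \<Theta>m"
         "dual_J A B \<Psi> \<Omega> \<nu> \<Theta>2 \<le> dual_J A B \<Psi> \<Omega> \<nu> \<Theta>m"
      using min1 min2 dom by (auto simp: is_arg_min_linorder)
    then show ?thesis by linarith
  qed
  finally have le: "circle_integral gap \<le> 0" .
  have "gap z = 0"
  proof (rule circle_integral_nonpos_imp_zero[OF cont_gap _ le z])
    show "0 \<le> gap z" if "z \<in> sphere 0 1" for z
      unfolding gap
      using dual_potential_midpoint_le[OF \<nu> pos[OF dom(1) that] pos[OF dom(2) that]] \<Psi>(2)[OF that]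
      by (intro mult_nonneg_nonneg) auto
  qed
  then have "dual_potential \<nu> (s \<Theta>1 z) + dual_potential \<nu> (s \<Theta>2 z)
      - 2 * dual_potential \<nu> ((s \<Theta>1 z + s \<Theta>2 z) / 2) = 0"
    using \<Psi>(2)[OF z] by (auto simp: gap)
  then have "s \<Theta>1 z = s \<Theta>2 z"
    using dual_potential_midpoint_less[OF \<nu> pos[OF dom(1) z] pos[OF dom(2) z]] by fastforce
  then show ?thesis using \<nu> by (simp add: s_def)
qed

section \<open>The divergence from the correlogram is the dual function\<close>

text \<open>
  The part of the divergence integrand that does not depend on \<open>\<Theta>\<close>. For
  \<open>\<nu> > 1\<close> it consists of the pure term in \<open>\<Omega>\<close>, with
  \<open>1 / (\<beta> (\<beta> - 1)) = - \<nu>\<^sup>2 / (\<nu> - 1)\<close> at \<open>\<beta> = 1 - \<nu>\<inverse>\<close>, and of the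
  summand \<open>\<nu> \<Omega>\<close> of the cross term \<open>\<nu> \<Omega> s = \<nu> \<Omega> + \<Omega> G\<^sup>* \<Theta> G\<close>.
\<close>

definition divergence_offset ::
    "(complex \<Rightarrow> real) \<Rightarrow> (complex \<Rightarrow> real) \<Rightarrow> nat \<Rightarrow> complex \<Rightarrow> real" where
  "divergence_offset \<Psi> \<Omega> \<nu> z =
     (if \<nu> = 1 then \<Psi> z * (ln (\<Psi> z) - ln (\<Omega> z) - 1) + \<Omega> z
      else \<Psi> z powr inverse (real \<nu>) * (- (real \<nu>)\<^sup>2 / (real \<nu> - 1)
          * \<Omega> z powr (1 - inverse (real \<nu>))) + real \<nu> * \<Omega> z)"

text \<open>
  The identity holds pointwise under the integral. For \<open>\<nu> = 1\<close> it is the cancellation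
  \<open>\<Psi> \<Omega> (\<Psi> / s)\<inverse> = \<Omega> s\<close>; for \<open>\<nu> > 1\<close> it rests on
  the two exponent computations marked in the proof.
\<close>

lemma S_B2_eq_dual_J:
  assumes A: "schur_stable A"
    and \<Psi>: "continuous_on (sphere 0 1) \<Psi>" "\<And>z. z \<in> sphere 0 1 \<Longrightarrow> 0 < \<Psi> z"
    and \<Omega>: "continuous_on (sphere 0 1) \<Omega>" "\<And>z. z \<in> sphere 0 1 \<Longrightarrow> 0 < \<Omega> z"
    and \<nu>: "1 \<le> \<nu>" and \<Theta>: "\<Theta> \<in> D_A A B \<nu>"
  shows "S_B2 (\<lambda>z. \<Psi> z powr inverse (real \<nu>)) (1 - inverse (real \<nu>)) \<Omega> (A_density A B \<Psi> \<nu> \<Theta>)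
    = dual_J A B \<Psi> \<Omega> \<nu> \<Theta> + circle_integral (divergence_offset \<Psi> \<Omega> \<nu>)"
proof -
  let ?J = "dual_integrand A B \<Psi> \<Omega> \<nu> \<Theta>" and ?K = "divergence_offset \<Psi> \<Omega> \<nu>"
  have "continuous_on (sphere 0 1) ?K"
  proof -
    have "\<forall>z\<in>sphere 0 1. \<Psi> z \<noteq> 0" "\<forall>z\<in>sphere 0 1. \<Omega> z \<noteq> 0"
      using \<Psi>(2) \<Omega>(2) by (metis less_irrefl)+
    note intros = continuous_on_add continuous_on_mult continuous_on_diff continuous_on_ln
      continuous_on_powr continuous_on_const \<Psi>(1) \<Omega>(1) this
    show ?thesis
    proof (cases "\<nu> = 1")
      case True
      show ?thesis
        unfolding divergence_offset_def[abs_def] if_P[OF True] by (intro intros)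
    next
      case False
      show ?thesis
        unfolding divergence_offset_def[abs_def] if_not_P[OF False] by (intro intros)
    qed
  qed
  then have sum: "circle_integral (\<lambda>z. ?J z + ?K z) = dual_J A B \<Psi> \<Omega> \<nu> \<Theta> + circle_integral ?K"
    by (simp add: circle_integral_add continuous_on_dual_integrand[OF A \<Psi>(1) \<Omega>(1) \<nu> \<Theta>]
        dual_J_eq_circle_integral[OF A \<Psi>(1) \<Omega>(1) \<nu> \<Theta>])
  show ?thesis
  proof (cases "\<nu> = 1")
    case True
    then have b0: "1 - inverse (real \<nu>) = 0" by simp
    have "\<Psi> z powr inverse (real \<nu>) * (ln (A_density A B \<Psi> \<nu> \<Theta> z) - ln (\<Omega> z)
        + \<Omega> z * inverse (A_density A B \<Psi> \<nu> \<Theta> z) - 1) = ?J z + ?K z"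
      if z: "z \<in> sphere 0 1" for z
    proof -
      have "0 < 1 + Gstar_Theta_G A B \<Theta> z" using \<Theta> z True by (auto simp: D_A_def)
      then show ?thesis
        using \<Psi>(2)[OF z] True
        by (simp add: dual_integrand_def divergence_offset_def A_density_def dual_potential_def
            ln_div field_simps)
    qed
    then show ?thesis
      unfolding sum[symmetric] S_B2_def S_IS_def if_P[OF b0] by (rule circle_integral_cong)
  next
    case False
    let ?b = "1 - inverse (real \<nu>)"
    have n: "real \<nu> > 1" using False \<nu> by simp
    have b0: "?b \<noteq> 0" using n by (simp add: field_simps)
    have "\<Psi> z powr inverse (real \<nu>) *
        (1 / (?b * (?b - 1)) * \<Omega> z powr ?b
         - 1 / (?b - 1) * \<Omega> z * A_density A B \<Psi> \<nu> \<Theta> z powr (?b - 1)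
         + 1 / ?b * A_density A B \<Psi> \<nu> \<Theta> z powr ?b) = ?J z + ?K z"
      if z: "z \<in> sphere 0 1" for z
    proof -
      define s where "s = 1 + inverse (real \<nu>) * Gstar_Theta_G A B \<Theta> z"
      define P where "P = \<Psi> z powr inverse (real \<nu>)"
      have s: "0 < s" using \<Theta> z by (auto simp: D_A_def s_def)
      have \<Psi>z: "0 < \<Psi> z" by (rule \<Psi>(2)[OF z])
      have P: "0 < P" using \<Psi>z by (simp add: P_def)
      have dens: "A_density A B \<Psi> \<nu> \<Theta> z = \<Psi> z * s powr (- real \<nu>)"
        using s by (simp add: A_density_def s_def[symmetric] powr_minus powr_realpow divide_inverse)
      \<comment> \<open>The cross term: \<open>- \<nu> (\<beta> - 1) = 1\<close> makes it linear in \<open>s\<close>, and the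
        weight cancels \<open>\<Psi>\<close>.\<close>
      have "A_density A B \<Psi> \<nu> \<Theta> z powr (?b - 1) = \<Psi> z powr (- inverse (real \<nu>)) * s"
        using s \<Psi>z n by (simp add: dens powr_mult powr_powr)
      then have e1: "P * A_density A B \<Psi> \<nu> \<Theta> z powr (?b - 1) = s"
        using P by (simp add: P_def powr_minus)
      \<comment> \<open>The pure term: \<open>- \<nu> \<beta> = 1 - \<nu>\<close>, and the weight completes
        \<open>\<Psi>\<^bsup>\<beta>\<^esup>\<close> to \<open>\<Psi>\<close>.\<close>
      have "A_density A B \<Psi> \<nu> \<Theta> z powr ?b = \<Psi> z powr ?b * s powr (1 - real \<nu>)"
        using s \<Psi>z n by (simp add: dens powr_mult powr_powr algebra_simps)
      then have e2: "P * A_density A B \<Psi> \<nu> \<Theta> z powr ?b = \<Psi> z * s powr (1 - real \<nu>)"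
        using \<Psi>z by (simp add: P_def powr_add[symmetric] mult.assoc[symmetric])
      have c: "1 / (?b * (?b - 1)) = - (real \<nu>)\<^sup>2 / (real \<nu> - 1)" "1 / (?b - 1) = - real \<nu>"
          "1 / ?b = real \<nu> / (real \<nu> - 1)"
        using n by (simp_all add: field_simps power2_eq_square)
      have expand: "P * (c1 * W - c2 * V * X + c3 * Y)
          = P * (c1 * W) + (- c2) * V * (P * X) + c3 * (P * Y)" for c1 c2 c3 V W X Y
        by (simp add: algebra_simps)
      have "P * (1 / (?b * (?b - 1)) * \<Omega> z powr ?b
         - 1 / (?b - 1) * \<Omega> z * A_density A B \<Psi> \<nu> \<Theta> z powr (?b - 1)
         + 1 / ?b * A_density A B \<Psi> \<nu> \<Theta> z powr ?b)
        = P * (- (real \<nu>)\<^sup>2 / (real \<nu> - 1) * \<Omega> z powr ?b)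
          + real \<nu> * \<Omega> z * (P * A_density A B \<Psi> \<nu> \<Theta> z powr (?b - 1))
          + real \<nu> / (real \<nu> - 1) * (P * A_density A B \<Psi> \<nu> \<Theta> z powr ?b)"
        unfolding expand c by (simp only: minus_minus)
      also have "\<dots> = ?J z + ?K z"
      proof -
        have "real \<nu> * s = real \<nu> + Gstar_Theta_G A B \<Theta> z"
          using n by (simp add: s_def field_simps)
        then have "real \<nu> * \<Omega> z * s = \<Omega> z * (real \<nu> + Gstar_Theta_G A B \<Theta> z)"
          by (metis mult.assoc mult.left_commute)
        then show ?thesis
          unfolding e1 e2 using False
          by (simp add: dual_integrand_def divergence_offset_def dual_potential_def
              s_def[symmetric] P_def[symmetric] algebra_simps)
      qed
      finally show ?thesis by (simp only: P_def)
    qed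
    then show ?thesis
      unfolding sum[symmetric] S_B2_def if_not_P[OF b0] by (rule circle_integral_cong)
  qed
qed

section \<open>Minimizers of the divergence\<close>

lemma continuous_on_correlogram: "continuous_on (sphere 0 1) (correlogram y N M w)"
  unfolding correlogram_def[abs_def] correlogram_complex_def
  by (intro continuous_intros) auto

lemma continuous_on_rational:
  assumes "rational_on_circle \<Psi>"
  shows "continuous_on (sphere 0 1) \<Psi>"
proof -
  obtain p q where pq: "\<forall>z\<in>sphere 0 1. poly q z \<noteq> 0 \<and> complex_of_real (\<Psi> z) = poly p z / poly q z"
    using assms by (auto simp: rational_on_circle_def)
  have *: "continuous_on (sphere 0 1) (\<lambda>z. Re (poly p z / poly q z))"
    using pq by (intro continuous_intros) auto
  have "Re (poly p z / poly q z) = \<Psi> z" if "z \<in> sphere 0 1" for z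
    using pq that by (metis Re_complex_of_real)
  with * show ?thesis by (rule continuous_on_eq)
qed

theorem proposition4:
  fixes A :: "real ^ 'n ^ 'n" and B :: "real ^ 'n"
    and \<Psi> \<Omega> :: "complex \<Rightarrow> real"
    and y w :: "nat \<Rightarrow> real" and N M \<nu> :: nat
    and \<Theta>hat :: "real ^ 'n ^ 'n"
  assumes "CARD('n) > 1"
    and "schur_stable A"
    and "reachable A B"
    and "\<Psi> \<in> S1_plus" and "rational_on_circle \<Psi>"
    and "M \<le> N" and "w 0 = 1"
    and "\<Omega> = correlogram y N M w"
    and "\<And>z. z \<in> sphere 0 1 \<Longrightarrow> \<Omega> z > 0"
    and "\<nu> \<ge> 1"
    and "is_arg_min (dual_J A B \<Psi> \<Omega> \<nu>) (\<lambda>\<Theta>. \<Theta> \<in> D_A A B \<nu>) \<Theta>hat"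
  shows "let dist_to_\<Omega> =
      S_B2 (\<lambda>z. \<Psi> z powr inverse (real \<nu>)) (1 - inverse (real \<nu>)) \<Omega> in
    is_arg_min (\<lambda>\<Theta>. dist_to_\<Omega> (A_density A B \<Psi> \<nu> \<Theta>)) (\<lambda>\<Theta>. \<Theta> \<in> D_A A B \<nu>) \<Theta>hat
    \<and> is_arg_min dist_to_\<Omega> (\<lambda>\<Phi>. \<Phi> \<in> M_A A B \<Psi> \<nu>) (A_density A B \<Psi> \<nu> \<Theta>hat)
    \<and> (\<forall>\<Phi>. is_arg_min dist_to_\<Omega> (\<lambda>\<Phi>. \<Phi> \<in> M_A A B \<Psi> \<nu>) \<Phi> \<longrightarrow>
          (\<forall>z\<in>sphere 0 1. \<Phi> z = A_density A B \<Psi> \<nu> \<Theta>hat z))"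
proof -
  let ?D = "S_B2 (\<lambda>z. \<Psi> z powr inverse (real \<nu>)) (1 - inverse (real \<nu>)) \<Omega>"
  let ?J = "dual_J A B \<Psi> \<Omega> \<nu>"
  have \<Psi>: "continuous_on (sphere 0 1) \<Psi>" "\<And>z. z \<in> sphere 0 1 \<Longrightarrow> 0 < \<Psi> z"
    using continuous_on_rational[OF assms(5)] assms(4) by (force simp: S1_plus_def)+
  have \<Omega>: "continuous_on (sphere 0 1) \<Omega>"
    unfolding assms(8) by (rule continuous_on_correlogram)
  obtain K where K: "?D (A_density A B \<Psi> \<nu> \<Theta>) = ?J \<Theta> + K" if "\<Theta> \<in> D_A A B \<nu>" for \<Theta>
    using S_B2_eq_dual_J[OF assms(2) \<Psi> \<Omega> assms(9,10)] by blast
  note min = assms(11)[unfolded is_arg_min_linorder]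
  have min_density:
    "is_arg_min ?D (\<lambda>\<Phi>. \<Phi> \<in> M_A A B \<Psi> \<nu>) (A_density A B \<Psi> \<nu> \<Theta>hat)"
    using min by (auto simp: is_arg_min_linorder M_A_def K)
  have "\<Phi> z = A_density A B \<Psi> \<nu> \<Theta>hat z"
    if \<Phi>: "is_arg_min ?D (\<lambda>\<Phi>. \<Phi> \<in> M_A A B \<Psi> \<nu>) \<Phi>" and z: "z \<in> sphere 0 1" for \<Phi> z
  proof -
    obtain \<Theta> where \<Theta>: "\<Theta> \<in> D_A A B \<nu>" "\<Phi> = A_density A B \<Psi> \<nu> \<Theta>"
      using \<Phi> by (auto simp: is_arg_min_linorder M_A_def)
    have "?J \<Theta> \<le> ?J \<Theta>hat"
      using \<Phi> min_density min \<Theta> K by (force simp: is_arg_min_linorder)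
    then have "is_arg_min ?J (\<lambda>\<Theta>. \<Theta> \<in> D_A A B \<nu>) \<Theta>"
      using is_arg_min_antimono[OF assms(11)] \<Theta> by blast
    then have "Gstar_Theta_G A B \<Theta> z = Gstar_Theta_G A B \<Theta>hat z"
      using dual_J_minimizers_same_Gstar_Theta_G[OF assms(2) \<Psi> \<Omega> assms(10) _ assms(11) z] by blast
    then show ?thesis by (simp add: \<Theta> A_density_def)
  qed
  moreover have "is_arg_min (\<lambda>\<Theta>. ?D (A_density A B \<Psi> \<nu> \<Theta>)) (\<lambda>\<Theta>. \<Theta> \<in> D_A A B \<nu>) \<Theta>hat"
    using min by (auto simp: is_arg_min_linorder K)
  ultimately show ?thesis
    unfolding Let_def using min_density by blast
qed

end
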